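(* Let $u_0\in L^\infty(\Omega)$ satisfy $\langle u_0\rangle\notin[s_*,s^*]$, and let $u$ be the solution of Problem $(P)$ with initial data $u_0$. Then $\omega(u_0)$ has a unique element $\varphi$, which is the constant function $\varphi=\langle u_0\rangle$. Moreover, there exist constants $C_1,C_2>0$ such that $$\|u(t)-\langle u_0\rangle\|_{L^\infty(\Omega)}\le C_1\exp(-C_2t)\quad\text{for all }t\ge0.$$
   Context: $\Omega\subset\mathbb{R}^N$ ($N\ge1$) is a (nonempty) bounded open set, $|A|$ is the Lebesgue measure of $A$, and $\langle g\rangle:=\frac1{|\Omega|}\int_\Omega g\,dx$. The function $f:\mathbb{R}\to\mathbb{R}$ satisfies the following. $f\in C^1(\mathbb{R})$ and there are $m<M$ with $f'(m)=f'(M)=0$, $f'<0$ on $(-\infty,m)\cup(M,\infty)$, $f'>0$ on $(m,M)$; and there are $s_*<s^*$ with $s_*<m<M<s^*$, $f(s_* )=f(M)$, $f(s^* )=f(m)$. Problem $(P)$: $\frac{du}{dt}=f(u)-\langle f(u)\rangle$ for $t>0$, $u(0)=u_0$, viewed as an ordinary differential equation in $L^\infty(\Omega)$; for $u_0\in L^\infty(\Omega)$ it has a unique global solution $u\in C^1([0,\infty);L^\infty(\Omega))$. The $\omega$-limit set of $u_0$ is $$\omega(u_0):=\{\varphi\in L^1(\Omega):\ \exists\, t_n\to\infty \text{ with } u(t_n)\to\varphi \text{ in } L^1(\Omega)\text{ as }n\to\infty\}.$$ *)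

theory Defs
  imports "HOL-Analysis.Analysis" "HOL-Probability.Essential_Supremum"
begin

text \<open>
  Elements of \<open>L\<^sup>\<infinity>\<close> and of \<open>L\<^sup>1\<close> are represented by real-valued functions, and every
  notion below is invariant under changing a representative on a null set.  A curve in
  \<open>L\<^sup>\<infinity>\<close>, defined for times \<open>t \<ge> 0\<close>, is a function \<open>u\<close> such that \<open>u t\<close> is a representative of
  its value at time \<open>t\<close>; the values of \<open>u\<close> at negative times are irrelevant.
\<close>

text \<open>The value is \<open>\<infinity>\<close> if \<open>g\<close> is not measurable or not essentially bounded.\<close>

definition Linf_norm :: "'a measure \<Rightarrow> ('a \<Rightarrow> real) \<Rightarrow> ereal" where
  "Linf_norm M g = esssup M (\<lambda>x. ereal \<bar>g x\<bar>)"

definition Linf :: "'a measure \<Rightarrow> ('a \<Rightarrow> real) set" where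
  "Linf M = {g \<in> borel_measurable M. Linf_norm M g < \<infinity>}"

definition has_Linf_derivative ::
  "'a measure \<Rightarrow> (real \<Rightarrow> 'a \<Rightarrow> real) \<Rightarrow> ('a \<Rightarrow> real) \<Rightarrow> real \<Rightarrow> bool" where
  "has_Linf_derivative M u w t \<longleftrightarrow>
     ((\<lambda>s. Linf_norm M (\<lambda>x. (u s x - u t x) / (s - t) - w x)) \<longlongrightarrow> 0) (at t within {0..})"

definition continuous_Linf :: "'a measure \<Rightarrow> (real \<Rightarrow> 'a \<Rightarrow> real) \<Rightarrow> bool" where
  "continuous_Linf M v \<longleftrightarrow> (\<forall>t\<ge>0. v t \<in> Linf M) \<and>
     (\<forall>t\<ge>0. ((\<lambda>s. Linf_norm M (\<lambda>x. v s x - v t x)) \<longlongrightarrow> 0) (at t within {0..}))"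

text \<open>\<open>u \<in> C\<^sup>1([0,\<infinity>); L\<^sup>\<infinity>)\<close> with derivative \<open>v\<close> (one-sided at time \<open>0\<close>).\<close>

definition C1_Linf ::
  "'a measure \<Rightarrow> (real \<Rightarrow> 'a \<Rightarrow> real) \<Rightarrow> (real \<Rightarrow> 'a \<Rightarrow> real) \<Rightarrow> bool" where
  "C1_Linf M u v \<longleftrightarrow> (\<forall>t\<ge>0. u t \<in> Linf M) \<and>
     (\<forall>t\<ge>0. has_Linf_derivative M u (v t) t) \<and> continuous_Linf M v"

definition mean :: "'a::euclidean_space set \<Rightarrow> ('a \<Rightarrow> real) \<Rightarrow> real" where
  "mean \<Omega> g = (LINT x|lebesgue_on \<Omega>. g x) / measure lebesgue \<Omega>"

definition solves_P ::
  "'a::euclidean_space set \<Rightarrow> (real \<Rightarrow> real) \<Rightarrow> ('a \<Rightarrow> real) \<Rightarrow> (real \<Rightarrow> 'a \<Rightarrow> real) \<Rightarrow> bool" where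
  "solves_P \<Omega> f u0 u \<longleftrightarrow>
     (\<exists>v. C1_Linf (lebesgue_on \<Omega>) u v \<and>
          (\<forall>t>0. AE x in lebesgue_on \<Omega>. v t x = f (u t x) - mean \<Omega> (\<lambda>y. f (u t y)))) \<and>
     (AE x in lebesgue_on \<Omega>. u 0 x = u0 x)"

definition ae_class :: "'a measure \<Rightarrow> ('a \<Rightarrow> real) \<Rightarrow> ('a \<Rightarrow> real) set" where
  "ae_class M g = {h \<in> borel_measurable M. AE x in M. h x = g x}"

text \<open>
  A set of elements of \<open>L\<^sup>1(\<Omega>)\<close>, that is, of classes modulo equality almost everywhere.
  The solution \<open>u\<close> with initial value \<open>u0\<close> is unique only up to the choice of
  representatives, whence the quantification over \<open>u\<close>.
\<close>

definition omega_limit ::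
  "'a::euclidean_space set \<Rightarrow> (real \<Rightarrow> real) \<Rightarrow> ('a \<Rightarrow> real) \<Rightarrow> ('a \<Rightarrow> real) set set" where
  "omega_limit \<Omega> f u0 =
     {ae_class (lebesgue_on \<Omega>) \<phi> | \<phi>. integrable (lebesgue_on \<Omega>) \<phi> \<and>
        (\<exists>u \<tau>. solves_P \<Omega> f u0 u \<and> (\<forall>n::nat. 0 \<le> \<tau> n) \<and> filterlim \<tau> at_top sequentially \<and>
           (\<lambda>n. LINT x|lebesgue_on \<Omega>. \<bar>u (\<tau> n) x - \<phi> x\<bar>) \<longlonglongrightarrow> 0)}"

definition bistable ::
  "(real \<Rightarrow> real) \<Rightarrow> real \<Rightarrow> real \<Rightarrow> real \<Rightarrow> real \<Rightarrow> bool" where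
  "bistable f m M s_low s_upp \<longleftrightarrow>
     f C1_differentiable_on UNIV \<and>
     m < M \<and> deriv f m = 0 \<and> deriv f M = 0 \<and>
     (\<forall>x \<in> {..<m} \<union> {M<..}. deriv f x < 0) \<and>
     (\<forall>x \<in> {m<..<M}. deriv f x > 0) \<and>
     s_low < m \<and> M < s_upp \<and> f s_low = f M \<and> f s_upp = f m"

end

theory Submission
  imports Defs
begin

text \<open>
  Let \<open>\<mu>\<close> be the mean of \<open>u\<^sub>0\<close>, which the flow preserves, and let \<open>a(t) \<le> \<mu> \<le> b(t)\<close> be the essential
  infimum and supremum of \<open>u(t)\<close>.  Since \<open>\<mu>\<close> lies outside \<open>[s\<^sub>*, s\<^sup>*]\<close>, \<open>f(s) - f(\<mu>)\<close> has the sign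
  opposite to \<open>s - \<mu>\<close> for every \<open>s \<noteq> \<mu>\<close>, and \<open>f'(\<mu>) < 0\<close>.  The nonlocal term is the same at every
  point, so it cancels in the oscillation \<open>w = b - a\<close>, whose upper right Dini derivative is at most
  \<open>f(b) - f(a) \<le> 0\<close>.  Hence \<open>w\<close> stays bounded by \<open>w(0)\<close>, on this bounded range
  \<open>f(b) - f(a) \<le> - c (b - a)\<close> with some \<open>c > 0\<close>, and therefore \<open>\<bar>u(t) - \<mu>\<bar> \<le> w(t) \<le> w(0) exp(- c t)\<close>.
\<close>

section \<open>Essential supremum and essential oscillation\<close>

text \<open>A real-valued counterpart of \<open>esssup\<close>, meaningful only for essentially bounded functions and
  measures that are not null (otherwise the infimum is a junk value).\<close>

definition essup :: "'a measure \<Rightarrow> ('a \<Rightarrow> real) \<Rightarrow> real" where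
  "essup M g = Inf {c. AE x in M. g x \<le> c}"

text \<open>Essential supremum minus essential infimum, the latter being
  \<open>- essup M (\<lambda>x. - g x)\<close>.\<close>

definition ess_osc :: "'a measure \<Rightarrow> ('a \<Rightarrow> real) \<Rightarrow> real" where
  "ess_osc M g = essup M g + essup M (\<lambda>x. - g x)"

text \<open>The condition \<open>ae_filter M \<noteq> bot\<close> says that the measure is not null;
  a statement free of \<open>x\<close> that holds almost everywhere then holds outright.\<close>

lemma AE_const_leD:
  fixes a b :: real
  assumes "ae_filter M \<noteq> bot" "AE x in M. a \<le> g x" "AE x in M. g x \<le> b"
  shows "a \<le> b"
proof -
  have "AE x in M. a \<le> b"
    using assms(2,3) by eventually_elim simp
  then show ?thesis
    using assms(1) by (simp add: eventually_const)
qed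

lemma essup_le:
  assumes "ae_filter M \<noteq> bot" "AE x in M. \<bar>g x\<bar> \<le> C" "AE x in M. g x \<le> c"
  shows "essup M g \<le> c"
  unfolding essup_def
proof (rule cInf_lower)
  have "AE x in M. - C \<le> g x"
    using assms(2) by eventually_elim simp
  from AE_const_leD[OF assms(1) this] show "bdd_below {c. AE x in M. g x \<le> c}"
    by (intro bdd_belowI[of _ "- C"]) simp
qed (use assms(3) in simp)

text \<open>The infimum is attained: the bounds \<open>essup M g + inverse (real (Suc n))\<close>
  hold off null sets, and countably many null sets have a null union.\<close>

lemma AE_le_essup:
  assumes "AE x in M. \<bar>g x\<bar> \<le> C"
  shows "AE x in M. g x \<le> essup M g"
proof -
  let ?S = "{c. AE x in M. g x \<le> c}"
  have "C \<in> ?S"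
    using assms by (auto elim: eventually_mono)
  then have ne: "?S \<noteq> {}" by blast
  have "AE x in M. g x \<le> essup M g + inverse (real (Suc n))" for n
  proof -
    have "Inf ?S < essup M g + inverse (real (Suc n))"
      by (simp add: essup_def)
    then obtain c where "c \<in> ?S" "c < essup M g + inverse (real (Suc n))"
      using cInf_lessD[OF ne] by blast
    then show ?thesis
      by (auto elim: eventually_mono)
  qed
  then have "AE x in M. \<forall>n. g x \<le> essup M g + inverse (real (Suc n))"
    by (simp add: AE_all_countable)
  then show ?thesis
  proof eventually_elim
    case (elim x)
    show ?case
    proof (rule field_le_epsilon)
      fix e :: real assume "0 < e"
      then obtain n where "inverse (real (Suc n)) < e"
        using reals_Archimedean by blast
      with elim[rule_format, of n] show "g x \<le> essup M g + e" by linarith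
    qed
  qed
qed

lemma AE_ge_essup_uminus:
  assumes "AE x in M. \<bar>g x\<bar> \<le> C"
  shows "AE x in M. - essup M (\<lambda>x. - g x) \<le> g x"
proof -
  have "AE x in M. - g x \<le> essup M (\<lambda>x. - g x)"
    using assms by (intro AE_le_essup) simp
  then show ?thesis by eventually_elim simp
qed

lemma ess_osc_le:
  assumes "ae_filter M \<noteq> bot" "AE x in M. \<bar>g x\<bar> \<le> C"
    and "AE x in M. g x \<le> b" "AE x in M. a \<le> g x"
  shows "ess_osc M g \<le> b - a"
proof -
  have "AE x in M. - g x \<le> - a"
    using assms(4) by eventually_elim simp
  then have "essup M (\<lambda>x. - g x) \<le> - a"
    using assms by (intro essup_le) auto
  with essup_le[OF assms(1-3)] show ?thesis
    by (simp add: ess_osc_def)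
qed

text \<open>Each end of the essential range moves by at most \<open>e\<close>, whence the factor
  2.\<close>

lemma ess_osc_le_perturb:
  assumes "ae_filter M \<noteq> bot" "AE x in M. \<bar>g x\<bar> \<le> C" "AE x in M. \<bar>h x - g x\<bar> \<le> e"
  shows "ess_osc M h \<le> ess_osc M g + 2 * e"
proof -
  have "AE x in M. \<bar>h x\<bar> \<le> C + e"
    using assms(2,3) by eventually_elim simp
  moreover have "AE x in M. h x \<le> essup M g + e"
    using AE_le_essup[OF assms(2)] assms(3) by eventually_elim simp
  moreover have "AE x in M. - essup M (\<lambda>x. - g x) - e \<le> h x"
    using AE_ge_essup_uminus[OF assms(2)] assms(3) by eventually_elim simp
  ultimately have "ess_osc M h \<le> (essup M g + e) - (- essup M (\<lambda>x. - g x) - e)"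
    by (rule ess_osc_le[OF assms(1)])
  then show ?thesis by (simp add: ess_osc_def)
qed

section \<open>Pointwise almost-everywhere form of the norm and of the derivative\<close>

lemma Linf_AE_bounded:
  assumes "g \<in> Linf M"
  obtains C where "C \<ge> 0" "AE x in M. \<bar>g x\<bar> \<le> C"
proof -
  have "Linf_norm M g < \<infinity>"
    using assms by (simp add: Linf_def)
  then obtain C where C: "Linf_norm M g \<le> ereal C"
    by (meson ereal_dense2 less_imp_le)
  have "AE x in M. ereal \<bar>g x\<bar> \<le> Linf_norm M g"
    unfolding Linf_norm_def by (rule esssup_AE)
  \<comment> \<open>Over a null measure the norm is minus infinity and \<open>C\<close> may be
    negative, hence the absolute value.\<close>
  then have "AE x in M. \<bar>g x\<bar> \<le> \<bar>C\<bar>"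
  proof eventually_elim
    case (elim x)
    then have "ereal \<bar>g x\<bar> \<le> ereal C" using C by (rule order_trans)
    then show ?case by simp
  qed
  then show ?thesis using that[of "\<bar>C\<bar>"] by simp
qed

lemma Linf_norm_le:
  assumes "g \<in> borel_measurable M" "AE x in M. \<bar>g x\<bar> \<le> c"
  shows "Linf_norm M g \<le> ereal c"
  unfolding Linf_norm_def using assms by (intro esssup_I) auto

lemma Linf_norm_less_AE:
  assumes "Linf_norm M g < ereal e"
  shows "AE x in M. \<bar>g x\<bar> \<le> e"
proof -
  have "AE x in M. ereal \<bar>g x\<bar> \<le> Linf_norm M g"
    unfolding Linf_norm_def by (rule esssup_AE)
  then show ?thesis
  proof eventually_elim
    case (elim x)
    then have "ereal \<bar>g x\<bar> < ereal e" using assms by (rule le_less_trans)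
    then show ?case by simp
  qed
qed

text \<open>Clearing the denominator of the difference quotient gives a first-order expansion
  uniform in \<open>x\<close>. The exceptional null set may depend on \<open>s\<close>.\<close>

lemma has_Linf_derivativeD:
  assumes "has_Linf_derivative M u w t" "0 < e"
  shows "\<forall>\<^sub>F s in at t within {0..}. AE x in M. \<bar>u s x - u t x - (s - t) * w x\<bar> \<le> e * \<bar>s - t\<bar>"
proof -
  have "\<forall>\<^sub>F s in at t within {0..}. Linf_norm M (\<lambda>x. (u s x - u t x) / (s - t) - w x) < ereal e"
    using assms unfolding has_Linf_derivative_def by (intro order_tendstoD(2)[where y=0]) auto
  moreover have "\<forall>\<^sub>F s in at t within {0..}. s \<noteq> t"
    by (simp add: eventually_at_filter)
  ultimately show ?thesis
  proof eventually_elim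
    case (elim s)
    from Linf_norm_less_AE[OF elim(1)] show ?case
    proof eventually_elim
      case (elim x)
      have "u s x - u t x - (s - t) * w x = ((u s x - u t x) / (s - t) - w x) * (s - t)"
        using \<open>s \<noteq> t\<close> by (simp add: field_simps)
      then show ?case
        using elim by (simp add: abs_mult mult_right_mono)
    qed
  qed
qed

text \<open>The expansion with error constant 1, together with the bound \<open>K\<close> on the
  derivative, shows that \<open>u s\<close> is within \<open>(K + 1) * \<bar>s - t\<bar>\<close> of
  \<open>u t\<close>, and the oscillation inherits this up to a factor 2.\<close>

lemma has_Linf_derivative_imp_ess_osc_continuous:
  assumes ne: "ae_filter M \<noteq> bot" and der: "has_Linf_derivative M u w t"
    and w: "AE x in M. \<bar>w x\<bar> \<le> K" and u: "AE x in M. \<bar>u t x\<bar> \<le> C"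
  shows "((\<lambda>s. ess_osc M (u s)) \<longlongrightarrow> ess_osc M (u t)) (at t within {0..})"
proof -
  have ev: "\<forall>\<^sub>F s in at t within {0..}. \<bar>ess_osc M (u s) - ess_osc M (u t)\<bar> \<le> 2 * ((K + 1) * \<bar>s - t\<bar>)"
    using has_Linf_derivativeD[OF der zero_less_one]
  proof eventually_elim
    case (elim s)
    have d: "AE x in M. \<bar>u s x - u t x\<bar> \<le> (K + 1) * \<bar>s - t\<bar>"
      using elim w
    proof eventually_elim
      case (elim x)
      have "\<bar>(s - t) * w x\<bar> \<le> \<bar>s - t\<bar> * K"
        using elim(2) by (simp add: abs_mult mult_left_mono)
      with elim(1) show ?case by (simp add: algebra_simps)
    qed
    \<comment> \<open>The perturbation bound is used in both directions, and the reverse one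
      requires \<open>u s\<close> to be bounded.\<close>
    have us: "AE x in M. \<bar>u s x\<bar> \<le> C + (K + 1) * \<bar>s - t\<bar>"
      using d u by eventually_elim linarith
    have d': "AE x in M. \<bar>u t x - u s x\<bar> \<le> (K + 1) * \<bar>s - t\<bar>"
      using d by eventually_elim linarith
    show ?case
      using ess_osc_le_perturb[OF ne u d] ess_osc_le_perturb[OF ne us d'] by linarith
  qed
  have "((\<lambda>s. 2 * ((K + 1) * \<bar>s - t\<bar>)) \<longlongrightarrow> 2 * ((K + 1) * \<bar>t - t\<bar>)) (at t within {0..})"
    by (intro tendsto_intros)
  then have "((\<lambda>s. 2 * ((K + 1) * \<bar>s - t\<bar>)) \<longlongrightarrow> 0) (at t within {0..})"
    by simp
  moreover have "\<forall>\<^sub>F s in at t within {0..}.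
      norm (ess_osc M (u s) - ess_osc M (u t)) \<le> 2 * ((K + 1) * \<bar>s - t\<bar>)"
    using ev by simp
  ultimately have "((\<lambda>s. ess_osc M (u s) - ess_osc M (u t)) \<longlongrightarrow> 0) (at t within {0..})"
    by (rule Lim_null_comparison[rotated])
  then show ?thesis
    by (simp add: LIM_zero_iff)
qed

section \<open>Lipschitz bound and the effect of one Euler step on the oscillation\<close>

lemma C1_imp_Lipschitz_on_interval:
  fixes f :: "real \<Rightarrow> real"
  assumes "f C1_differentiable_on UNIV"
  obtains L where "0 \<le> L" "\<And>x y. \<lbrakk>x \<in> {a..b}; y \<in> {a..b}\<rbrakk> \<Longrightarrow> \<bar>f x - f y\<bar> \<le> L * \<bar>x - y\<bar>"
proof -
  obtain D where D: "\<And>x. (f has_real_derivative D x) (at x)" and cD: "continuous_on UNIV D"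
    using assms unfolding C1_differentiable_on_def has_real_derivative_iff_has_vector_derivative by auto
  have "bounded (D ` {a..b})"
    by (intro compact_imp_bounded compact_continuous_image continuous_on_subset[OF cD]) auto
  then obtain L where L: "\<And>x. x \<in> {a..b} \<Longrightarrow> \<bar>D x\<bar> \<le> L"
    unfolding bounded_iff by (metis imageI real_norm_def)
  \<comment> \<open>The absolute value covers an empty interval, for which \<open>L\<close> may be
    negative.\<close>
  have "\<bar>f x - f y\<bar> \<le> \<bar>L\<bar> * \<bar>x - y\<bar>" if "x \<in> {a..b}" "y \<in> {a..b}" for x y
    using field_differentiable_bound[of "{a..b}" f D "\<bar>L\<bar>" x y, OF _ has_field_derivative_at_within[OF D]]
      order_trans[OF L abs_ge_self] that by simp
  then show ?thesis using that[of "\<bar>L\<bar>"] by simp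
qed

text \<open>For small \<open>h\<close> the Euler step \<open>y \<mapsto> y + h f(y)\<close> is monotone on \<open>[a, b]\<close>, so it maps the
  essential range of \<open>g\<close> between the images of its endpoints.\<close>

lemma ess_osc_Euler_step:
  assumes ne: "ae_filter M \<noteq> bot" and u: "AE x in M. \<bar>g x\<bar> \<le> C"
    and a: "a = - essup M (\<lambda>x. - g x)" and b: "b = essup M g"
    and L: "\<And>x y. \<lbrakk>x \<in> {a..b}; y \<in> {a..b}\<rbrakk> \<Longrightarrow> \<bar>f x - f y\<bar> \<le> L * \<bar>x - y\<bar>"
    and h: "0 < h" "h * L \<le> 1"
    and step: "AE x in M. \<bar>k x - g x - h * (f (g x) - l)\<bar> \<le> e"
  shows "ess_osc M k \<le> ess_osc M g + h * (f b - f a) + 2 * e"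
proof -
  have mono: "x + h * f x \<le> y + h * f y" if "x \<in> {a..b}" "y \<in> {a..b}" "x \<le> y" for x y
  proof -
    have "h * (f x - f y) \<le> h * (L * (y - x))"
      using L[OF that(1,2)] that(3) h by (intro mult_left_mono) auto
    also have "\<dots> = (h * L) * (y - x)"
      by simp
    also have "\<dots> \<le> 1 * (y - x)"
      using h that by (intro mult_right_mono) auto
    finally show ?thesis by (simp add: algebra_simps)
  qed
  have ab: "AE x in M. g x \<in> {a..b}"
    using AE_le_essup[OF u] AE_ge_essup_uminus[OF u] unfolding a b by eventually_elim simp
  have k: "AE x in M. a + h * f a - h * l - e \<le> k x \<and> k x \<le> b + h * f b - h * l + e"
    using step ab
  proof eventually_elim
    case (elim x)
    have "g x + h * f (g x) \<le> b + h * f b" "a + h * f a \<le> g x + h * f (g x)"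
      using elim(2) by (auto intro!: mono)
    with elim(1) show ?case
      by (simp add: abs_le_iff algebra_simps)
  qed
  let ?B = "max \<bar>a + h * f a - h * l - e\<bar> \<bar>b + h * f b - h * l + e\<bar>"
  have "AE x in M. \<bar>k x\<bar> \<le> ?B"
    using k by eventually_elim linarith
  moreover have "AE x in M. k x \<le> b + h * f b - h * l + e" "AE x in M. a + h * f a - h * l - e \<le> k x"
    using k by auto
  \<comment> \<open>The shift \<open>- h * l\<close> is common to both ends and cancels in the
    difference; this is how the nonlocal term disappears.\<close>
  ultimately have "ess_osc M k \<le> (b + h * f b - h * l + e) - (a + h * f a - h * l - e)"
    by (rule ess_osc_le[OF ne])
  then show ?thesis
    by (simp add: a b ess_osc_def algebra_simps)
qed

section \<open>Comparison principles for Dini derivatives\<close>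

text \<open>For a start \<open>c > a\<close> and a slope \<open>e > 0\<close>, compactness yields a
  last time at which \<open>z t - e * t \<le> z c - e * c\<close>. It must be \<open>b\<close>,
  since at an earlier time the Dini condition would carry the inequality further. Then
  \<open>e\<close> tends to 0, and \<open>c\<close> tends to \<open>a\<close> by continuity, the
  Dini condition being given only at interior times.\<close>

lemma Dini_nonpos_imp_le:
  fixes z :: "real \<Rightarrow> real"
  assumes cont: "continuous_on {a..b} z" and "a \<le> b"
    and dini: "\<And>t e. \<lbrakk>a < t; t < b; 0 < e\<rbrakk> \<Longrightarrow> \<forall>\<^sub>F h in at_right 0. z (t + h) \<le> z t + e * h"
  shows "z b \<le> z a"
proof -
  have slope: "z b \<le> z c + e * (b - c)" if c: "a < c" "c \<le> b" and e: "0 < e" for c e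
  proof -
    let ?S = "{t \<in> {c..b}. z t - e * t \<le> z c - e * c}"
    have cont': "continuous_on {c..b} (\<lambda>t. z t - e * t)"
      using c by (intro continuous_intros continuous_on_subset[OF cont]) auto
    have "closed ?S"
      using cont' by (intro continuous_on_closed_Collect_le) (auto intro!: continuous_intros)
    then have "compact ?S"
      by (intro compact_Int_closed[of "{c..b}" ?S, unfolded Int_absorb1[of ?S "{c..b}", OF Collect_restrict]]) auto
    moreover have "c \<in> ?S" using c by auto
    ultimately obtain s where s: "s \<in> ?S" and max: "\<And>t. t \<in> ?S \<Longrightarrow> t \<le> s"
      using compact_attains_sup[of ?S] by blast
    have "s = b"
    proof (rule ccontr)
      assume "s \<noteq> b"
      then have sb: "c \<le> s" "s < b" using s by auto
      have "\<forall>\<^sub>F h in at_right 0. z (s + h) \<le> z s + e * h"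
        using sb c e by (intro dini) auto
      moreover have "\<forall>\<^sub>F h in at_right 0. h < b - s"
        using sb by (intro order_tendstoD(2)[OF tendsto_ident_at]) auto
      ultimately have "\<forall>\<^sub>F h in at_right (0::real). z (s + h) \<le> z s + e * h \<and> h < b - s \<and> 0 < h"
        using eventually_at_right_less[of 0] by eventually_elim auto
      then obtain h where h: "z (s + h) \<le> z s + e * h" "h < b - s" "0 < h"
        using eventually_happens[of _ "at_right (0::real)"] by (auto simp: trivial_limit_at_right_real)
      have "s + h \<in> ?S"
        using h s sb by (simp add: algebra_simps)
      then have "s + h \<le> s" by (rule max)
      then show False using h by simp
    qed
    then show ?thesis using s by (simp add: algebra_simps)
  qed
  have le: "z b \<le> z c" if "a < c" "c \<le> b" for c
  proof (rule field_le_epsilon)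
    fix e :: real assume "0 < e"
    \<comment> \<open>The summand 1 avoids a zero denominator when \<open>c = b\<close> and still
      keeps the total contribution below \<open>e\<close>.\<close>
    then have "0 < e / (b - c + 1)" using that by simp
    from slope[OF that this] have "z b \<le> z c + e * ((b - c) / (b - c + 1))" by simp
    also have "\<dots> \<le> z c + e * 1"
      using \<open>0 < e\<close> that by (intro add_left_mono mult_left_mono) (auto simp: field_simps)
    finally show "z b \<le> z c + e" by simp
  qed
  show ?thesis
  proof (cases "a = b")
    case False
    then have "a < b" using assms by simp
    have "(z \<longlongrightarrow> z a) (at_right a)"
      using cont \<open>a < b\<close> by (simp add: continuous_on_Icc_at_rightD)
    moreover have "\<forall>\<^sub>F c in at_right a. z b \<le> z c"
      using eventually_at_right_real[OF \<open>a < b\<close>] by eventually_elim (auto intro: le)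
    ultimately show ?thesis
      by (rule tendsto_lowerbound) simp
  qed simp
qed

text \<open>With the integrating factor, \<open>w t * exp (c * t)\<close> has nonpositive upper
  right Dini derivative, so the previous comparison applies to it.\<close>

lemma Dini_Gronwall:
  fixes w :: "real \<Rightarrow> real"
  assumes cont: "continuous_on {0..b} w" and "0 \<le> b" and "0 \<le> c"
    and dini: "\<And>t e. \<lbrakk>0 < t; t < b; 0 < e\<rbrakk> \<Longrightarrow> \<forall>\<^sub>F h in at_right 0. w (t + h) \<le> w t - h * (c * w t) + e * h"
    and nonneg: "\<And>t. \<lbrakk>0 \<le> t; t \<le> b\<rbrakk> \<Longrightarrow> 0 \<le> w t"
  shows "w b \<le> w 0 * exp (- c * b)"
proof -
  have "w b * exp (c * b) \<le> w 0 * exp (c * 0)"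
  proof (rule Dini_nonpos_imp_le[where z = "\<lambda>t. w t * exp (c * t)"])
    fix t e :: real assume t: "0 < t" "t < b" and e: "0 < e"
    \<comment> \<open>The slack is divided by \<open>exp (c * b)\<close> to absorb the factor
      \<open>exp (c * (t + h))\<close>, which is no larger as long as
      \<open>h < b - t\<close>.\<close>
    have "\<forall>\<^sub>F h in at_right 0. w (t + h) \<le> w t - h * (c * w t) + e / exp (c * b) * h"
      using t e by (intro dini) auto
    moreover have "\<forall>\<^sub>F h in at_right (0::real). h < b - t"
      using t by (intro order_tendstoD(2)[OF tendsto_ident_at]) auto
    ultimately show "\<forall>\<^sub>F h in at_right 0. w (t + h) * exp (c * (t + h)) \<le> w t * exp (c * t) + e * h"
      using eventually_at_right_less[of 0]
    proof eventually_elim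
      case (elim h)
      have "1 + - (c * h) \<le> exp (- (c * h))" by (rule exp_ge_add_one_self)
      then have "w t * (1 - c * h) \<le> w t * exp (- (c * h))"
        using nonneg t by (intro mult_left_mono) auto
      with elim(1) have "w (t + h) \<le> w t * exp (- (c * h)) + e / exp (c * b) * h"
        by (simp add: algebra_simps)
      then have "w (t + h) * exp (c * (t + h)) \<le> (w t * exp (- (c * h)) + e / exp (c * b) * h) * exp (c * (t + h))"
        by (intro mult_right_mono) auto
      also have "\<dots> = w t * exp (c * t) + e * h * (exp (c * (t + h)) / exp (c * b))"
        by (simp add: distrib_right exp_add[symmetric] mult.assoc) (simp add: algebra_simps)
      also have "\<dots> \<le> w t * exp (c * t) + e * h * 1"
        using elim e \<open>0 \<le> c\<close> by (intro add_left_mono mult_left_mono) (auto intro!: mult_left_mono)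
      finally show ?case by simp
    qed
  qed (use \<open>0 \<le> b\<close> in \<open>auto intro!: continuous_intros cont\<close>)
  then have "w b * exp (c * b) * exp (- c * b) \<le> w 0 * exp (- c * b)"
    by (intro mult_right_mono) auto
  then show ?thesis
    by (simp add: mult.assoc exp_add[symmetric])
qed

section \<open>Sign and linear decay of the nonlinearity around an outer mean\<close>

text \<open>If \<open>\<mu> < s_low\<close>, then \<open>\<mu>\<close> is on the left decreasing
  branch and \<open>f \<mu>\<close> exceeds \<open>f s_low = f M\<close>, the largest value of
  \<open>f\<close> to the right of \<open>m\<close>. So \<open>f\<close> is above
  \<open>f \<mu>\<close> to the left of \<open>\<mu>\<close> and below it to the right. The case
  \<open>s_upp < \<mu>\<close> is the mirror image, with \<open>f m\<close> the smallest value to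
  the left of \<open>M\<close>.\<close>

lemma bistable_outer_sign:
  assumes "bistable f m M s_low s_upp" and "\<mu> \<notin> {s_low..s_upp}" and "s \<noteq> \<mu>"
  shows "(f s - f \<mu>) * (s - \<mu>) < 0"
proof -
  have mM: "m < M" and neg: "\<And>x. x < m \<or> M < x \<Longrightarrow> deriv f x < 0"
    and pos: "\<And>x. m < x \<Longrightarrow> x < M \<Longrightarrow> 0 < deriv f x"
    and s: "s_low < m" "M < s_upp" "f s_low = f M" "f s_upp = f m"
    and C1: "f C1_differentiable_on UNIV"
    using assms(1) unfolding bistable_def by auto
  have D: "(f has_real_derivative deriv f x) (at x)" for x
    using C1 by (simp add: C1_differentiable_on_eq DERIV_deriv_iff_real_differentiable)
  then have cont: "continuous_on A f" for A
    by (meson DERIV_isCont continuous_at_imp_continuous_on)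
  \<comment> \<open>The derivative vanishes at \<open>m\<close> and \<open>M\<close>, so strict
    monotonicity up to these points uses its sign on open intervals only.\<close>
  have left: "f y < f x" if "x < y" "y \<le> m" for x y
    using that neg D by (intro DERIV_neg_imp_decreasing_open[OF \<open>x < y\<close> _ cont]) fastforce
  have right: "f y < f x" if "x < y" "M \<le> x" for x y
    using that neg D by (intro DERIV_neg_imp_decreasing_open[OF \<open>x < y\<close> _ cont]) fastforce
  have mid: "f x < f y" if "x < y" "m \<le> x" "y \<le> M" for x y
    using that pos D by (intro DERIV_pos_imp_increasing_open[OF \<open>x < y\<close> _ cont]) fastforce
  have "\<mu> < s_low \<or> s_upp < \<mu>"
    using assms(2) by auto
  then have "s < \<mu> \<and> f \<mu> < f s \<or> \<mu> < s \<and> f s < f \<mu>"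
  proof
    assume \<mu>: "\<mu> < s_low"
    then have "f M < f \<mu>"
      using left[of \<mu> s_low] s by simp
    moreover have "f s < f M" if "M < s"
      using right[of M s] that by simp
    moreover have "f s \<le> f M" if "m < s" "s \<le> M"
      using mid[of s M] that by fastforce
    ultimately show ?thesis
      using left[of s \<mu>] left[of \<mu> s] \<mu> s assms(3) by (smt (verit))
  next
    assume \<mu>: "s_upp < \<mu>"
    then have "f \<mu> < f m"
      using right[of s_upp \<mu>] s by simp
    moreover have "f m < f s" if "s < m"
      using left[of s m] that by simp
    moreover have "f m \<le> f s" if "m \<le> s" "s < M"
      using mid[of m s] that by fastforce
    ultimately show ?thesis
      using right[of s \<mu>] right[of \<mu> s] \<mu> s assms(3) by (smt (verit))
  qed
  then show ?thesis
    by (auto simp: mult_less_0_iff)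
qed

text \<open>The slope of the chord from \<open>\<mu>\<close> to \<open>z\<close>, extended by
  \<open>deriv f \<mu>\<close> at \<open>z = \<mu>\<close>, is continuous and negative everywhere.
  Its maximum over the compact interval of radius \<open>R\<close> is therefore negative, and
  \<open>c\<close> is minus that maximum.\<close>

lemma decay_rate_exists:
  fixes f :: "real \<Rightarrow> real"
  assumes C1: "f C1_differentiable_on UNIV" and "0 \<le> R"
    and sign: "\<And>s. s \<noteq> \<mu> \<Longrightarrow> (f s - f \<mu>) * (s - \<mu>) < 0" and "deriv f \<mu> < 0"
  obtains c where "0 < c"
    "\<And>a b. \<lbrakk>\<mu> - R \<le> a; a \<le> \<mu>; \<mu> \<le> b; b \<le> \<mu> + R\<rbrakk> \<Longrightarrow> f b - f a \<le> - c * (b - a)"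
proof -
  have D: "(f has_real_derivative deriv f x) (at x)" for x
    using C1 by (simp add: C1_differentiable_on_eq DERIV_deriv_iff_real_differentiable)
  obtain q where q: "\<And>z. f z - f \<mu> = q z * (z - \<mu>)" "isCont q \<mu>" "q \<mu> = deriv f \<mu>"
    using D[of \<mu>] unfolding CARAT_DERIV by blast
  have neg: "q z < 0" for z
  proof (cases "z = \<mu>")
    case False
    have "q z * (z - \<mu>)\<^sup>2 < 0"
      using sign[OF False] by (simp add: q(1) power2_eq_square)
    then show ?thesis using False by (simp add: mult_less_0_iff not_less zero_le_power2)
  qed (use assms q in simp)
  \<comment> \<open>Caratheodory's criterion gives continuity at \<open>\<mu>\<close> alone;
    elsewhere \<open>q\<close> agrees locally with the difference quotient.\<close>
  have "isCont q z" for z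
  proof (cases "z = \<mu>")
    case False
    have "isCont (\<lambda>y. (f y - f \<mu>) / (y - \<mu>)) z"
      using False DERIV_isCont[OF D] by (intro continuous_intros) auto
    moreover have "\<forall>\<^sub>F y in nhds z. (f y - f \<mu>) / (y - \<mu>) = q y"
      using t1_space_nhds[OF False] by eventually_elim (simp add: q(1))
    ultimately show ?thesis
      by (rule isCont_cong[THEN iffD1, rotated])
  qed (use q in simp)
  then have "continuous_on {\<mu> - R..\<mu> + R} q"
    by (simp add: continuous_at_imp_continuous_on)
  then obtain z where z: "\<forall>y\<in>{\<mu> - R..\<mu> + R}. q y \<le> q z"
    using continuous_attains_sup[of "{\<mu> - R..\<mu> + R}" q] \<open>0 \<le> R\<close> by auto
  show ?thesis
  proof (rule that[of "- q z"])
    fix a b assume ab: "\<mu> - R \<le> a" "a \<le> \<mu>" "\<mu> \<le> b" "b \<le> \<mu> + R"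
    have "f b - f \<mu> \<le> q z * (b - \<mu>)"
      unfolding q(1) using z ab by (intro mult_right_mono) auto
    moreover have "q z * (a - \<mu>) \<le> f a - f \<mu>"
      unfolding q(1) using z ab by (intro mult_right_mono_neg) auto
    ultimately show "f b - f a \<le> - (- q z) * (b - a)"
      by (simp add: algebra_simps)
  qed (use neg in simp)
qed

section \<open>Integrals, means and conservation of the mean\<close>

lemma Linf_integrable:
  assumes "finite_measure M" "g \<in> Linf M"
  shows "integrable M g"
proof -
  obtain C where "AE x in M. \<bar>g x\<bar> \<le> C"
    using Linf_AE_bounded[OF assms(2)] by metis
  then show ?thesis
    using assms by (intro finite_measure.integrable_const_bound[of M g C]) (auto simp: Linf_def)
qed

lemma abs_integral_le_const:
  fixes g :: "'a \<Rightarrow> real"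
  assumes "finite_measure M" "integrable M g" "AE x in M. \<bar>g x\<bar> \<le> c"
  shows "\<bar>\<integral>x. g x \<partial>M\<bar> \<le> c * measure M (space M)"
proof -
  have "\<bar>\<integral>x. g x \<partial>M\<bar> \<le> (\<integral>x. \<bar>g x\<bar> \<partial>M)"
    by (rule integral_abs_bound)
  also have "\<dots> \<le> (\<integral>x. c \<partial>M)"
    using assms by (intro integral_mono_AE) (auto intro: finite_measure.integrable_const)
  finally show ?thesis by (simp add: mult.commute)
qed

text \<open>Over a finite measure, a remainder bounded almost everywhere by a multiple of
  \<open>\<bar>s - t\<bar>\<close> has an integral bounded by that multiple times the total
  mass.\<close>

lemma has_real_derivative_integral_Linf:
  assumes fin: "finite_measure M" and der: "has_Linf_derivative M u w t"
    and u: "\<And>s. 0 \<le> s \<Longrightarrow> u s \<in> Linf M" and w: "w \<in> Linf M" and t: "0 \<le> t"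
  shows "((\<lambda>s. \<integral>x. u s x \<partial>M) has_real_derivative (\<integral>x. w x \<partial>M)) (at t within {0..})"
  unfolding has_field_derivative_iff
proof (rule tendstoI)
  fix e :: real assume e: "0 < e"
  define A where "A = measure M (space M)"
  have A: "0 \<le> A" by (simp add: A_def)
  \<comment> \<open>Dividing by \<open>A + 1\<close> makes the final error
    \<open>e * (A / (A + 1))\<close> strictly less than \<open>e\<close>, also when
    \<open>A = 0\<close>.\<close>
  have "0 < e / (A + 1)" using e A by simp
  note has_Linf_derivativeD[OF der this]
  moreover have "\<forall>\<^sub>F s in at t within {0..}. s \<noteq> t \<and> 0 \<le> s"
    by (simp add: eventually_at_filter)
  ultimately show "\<forall>\<^sub>F s in at t within {0..}.
      dist (((\<integral>x. u s x \<partial>M) - (\<integral>x. u t x \<partial>M)) / (s - t)) (\<integral>x. w x \<partial>M) < e"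
  proof eventually_elim
    case (elim s)
    have int: "integrable M (u s)" "integrable M (u t)" "integrable M w"
      using elim u t w by (auto intro: Linf_integrable[OF fin])
    have "\<bar>\<integral>x. u s x - u t x - (s - t) * w x \<partial>M\<bar> \<le> e / (A + 1) * \<bar>s - t\<bar> * A"
      unfolding A_def using elim int by (intro abs_integral_le_const[OF fin]) (auto simp: A_def)
    also have "(\<integral>x. u s x - u t x - (s - t) * w x \<partial>M)
        = (((\<integral>x. u s x \<partial>M) - (\<integral>x. u t x \<partial>M)) / (s - t) - (\<integral>x. w x \<partial>M)) * (s - t)"
      using int elim by (simp add: field_simps)
    finally have "\<bar>((\<integral>x. u s x \<partial>M) - (\<integral>x. u t x \<partial>M)) / (s - t) - (\<integral>x. w x \<partial>M)\<bar> * \<bar>s - t\<bar>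
        \<le> e / (A + 1) * \<bar>s - t\<bar> * A"
      by (simp only: abs_mult)
    also have "\<dots> = e * (A / (A + 1)) * \<bar>s - t\<bar>"
      by simp
    finally have "\<bar>((\<integral>x. u s x \<partial>M) - (\<integral>x. u t x \<partial>M)) / (s - t) - (\<integral>x. w x \<partial>M)\<bar> \<le> e * (A / (A + 1))"
      by (rule mult_right_le_imp_le) (use elim in simp)
    also have "\<dots> < e * 1"
      using e A by (intro mult_strict_left_mono) (auto simp: field_simps)
    finally show ?case by (simp add: dist_real_def)
  qed
qed

lemma lebesgue_on_bounded_open:
  assumes "open \<Omega>" "bounded \<Omega>" "\<Omega> \<noteq> {}"
  shows "finite_measure (lebesgue_on \<Omega>)" "0 < measure lebesgue \<Omega>"
    "measure (lebesgue_on \<Omega>) (space (lebesgue_on \<Omega>)) = measure lebesgue \<Omega>"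
    "ae_filter (lebesgue_on \<Omega>) \<noteq> bot"
proof -
  have lm: "\<Omega> \<in> lmeasurable"
    using assms by (simp add: lmeasurable_open)
  show fin: "finite_measure (lebesgue_on \<Omega>)"
    by (rule finite_measure_lebesgue_on[OF lm])
  have "\<not> negligible \<Omega>"
    using assms open_not_negligible by blast
  then show pos: "0 < measure lebesgue \<Omega>"
    using lm by (simp add: negligible_iff_measure0 zero_less_measure_iff fmeasurableD less_le)
  show m: "measure (lebesgue_on \<Omega>) (space (lebesgue_on \<Omega>)) = measure lebesgue \<Omega>"
    using lm by (simp add: measure_restrict_space fmeasurableD space_restrict_space)
  show "ae_filter (lebesgue_on \<Omega>) \<noteq> bot"
    using pos m by (metis ae_filter_eq_bot_iff measure_def enn2real_0 less_irrefl)
qed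

lemma mean_between:
  assumes \<Omega>: "open \<Omega>" "bounded \<Omega>" "\<Omega> \<noteq> {}" and g: "g \<in> Linf (lebesgue_on \<Omega>)"
    and "AE x in lebesgue_on \<Omega>. a \<le> g x" "AE x in lebesgue_on \<Omega>. g x \<le> b"
  shows "a \<le> mean \<Omega> g" "mean \<Omega> g \<le> b"
proof -
  note M = lebesgue_on_bounded_open[OF \<Omega>]
  have int: "integrable (lebesgue_on \<Omega>) g" "\<And>c::real. integrable (lebesgue_on \<Omega>) (\<lambda>x. c)"
    using M g by (auto intro: Linf_integrable finite_measure.integrable_const)
  have "(LINT x|lebesgue_on \<Omega>. a) \<le> (LINT x|lebesgue_on \<Omega>. g x)"
    by (rule integral_mono_AE[OF int(2) int(1) assms(5)])
  moreover have "(LINT x|lebesgue_on \<Omega>. g x) \<le> (LINT x|lebesgue_on \<Omega>. b)"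
    by (rule integral_mono_AE[OF int(1) int(2) assms(6)])
  moreover have "(LINT x|lebesgue_on \<Omega>. c) = c * measure lebesgue \<Omega>" for c :: real
    unfolding lebesgue_integral_const M(3) by simp
  ultimately have "a * measure lebesgue \<Omega> \<le> (LINT x|lebesgue_on \<Omega>. g x)"
    "(LINT x|lebesgue_on \<Omega>. g x) \<le> b * measure lebesgue \<Omega>"
    by metis+
  then show "a \<le> mean \<Omega> g" "mean \<Omega> g \<le> b"
    using M(2) by (simp_all add: mean_def field_simps)
qed

lemma Linf_compose_continuous:
  assumes "continuous_on UNIV f" "g \<in> Linf M"
  shows "(\<lambda>x. f (g x)) \<in> Linf M"
proof -
  obtain C where C: "AE x in M. \<bar>g x\<bar> \<le> C"
    using Linf_AE_bounded[OF assms(2)] by metis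
  have "bounded (f ` {-C..C})"
    by (intro compact_imp_bounded compact_continuous_image continuous_on_subset[OF assms(1)]) auto
  then obtain B where B: "\<forall>y\<in>{-C..C}. \<bar>f y\<bar> \<le> B"
    by (auto simp: bounded_iff)
  have meas: "(\<lambda>x. f (g x)) \<in> borel_measurable M"
    using borel_measurable_continuous_onI[OF assms(1)] assms(2)
    by (auto simp: Linf_def intro: measurable_compose)
  have "AE x in M. \<bar>f (g x)\<bar> \<le> B"
    using C by eventually_elim (intro B[rule_format], auto)
  from Linf_norm_le[OF meas this] meas show ?thesis
    by (auto simp: Linf_def le_less_trans)
qed

text \<open>The right-hand side of the equation has integral zero, so the integral of
  \<open>u t\<close> has zero derivative at positive times.\<close>

lemma solves_P_mean_conserved:
  assumes \<Omega>: "open \<Omega>" "bounded \<Omega>" "\<Omega> \<noteq> {}" and f: "continuous_on UNIV f"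
    and u0: "u0 \<in> Linf (lebesgue_on \<Omega>)" and sol: "solves_P \<Omega> f u0 u" and t: "0 \<le> t"
  shows "mean \<Omega> (u t) = mean \<Omega> u0"
proof -
  let ?M = "lebesgue_on \<Omega>"
  note M = lebesgue_on_bounded_open[OF \<Omega>]
  obtain v where C1: "C1_Linf ?M u v"
    and ode: "\<And>t. 0 < t \<Longrightarrow> AE x in ?M. v t x = f (u t x) - mean \<Omega> (\<lambda>y. f (u t y))"
    and init: "AE x in ?M. u 0 x = u0 x"
    using sol unfolding solves_P_def by blast
  have u: "\<And>t. 0 \<le> t \<Longrightarrow> u t \<in> Linf ?M" and v: "\<And>t. 0 \<le> t \<Longrightarrow> v t \<in> Linf ?M"
    and der: "\<And>t. 0 \<le> t \<Longrightarrow> has_Linf_derivative ?M u (v t) t"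
    using C1 by (auto simp: C1_Linf_def continuous_Linf_def)
  define I where "I = (\<lambda>s. \<integral>x. u s x \<partial>?M)"
  have dI: "(I has_real_derivative (\<integral>x. v s x \<partial>?M)) (at s within {0..})" if "0 \<le> s" for s
    unfolding I_def using that by (intro has_real_derivative_integral_Linf M der u v)
  have "I t = I 0"
  proof (cases "t = 0")
    case False
    show ?thesis
    \<comment> \<open>The equation is available for positive times only; at time 0 continuity of
      \<open>I\<close> is enough.\<close>
    proof (rule DERIV_isconst_end[of 0 t I])
      have "continuous_on {0..} I"
        using dI by (meson DERIV_continuous_on atLeast_iff)
      then show "continuous_on {0..t} I"
        by (rule continuous_on_subset) auto
    next
      fix s assume s: "0 < s" "s < t"
      have "(\<integral>x. v s x \<partial>?M) = (\<integral>x. f (u s x) - mean \<Omega> (\<lambda>y. f (u s y)) \<partial>?M)"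
        using v[of s] u[of s] Linf_compose_continuous[OF f u[of s]] s ode[of s]
        by (intro integral_cong_AE) (auto simp: Linf_def)
      also have "\<dots> = (\<integral>x. f (u s x) \<partial>?M) - mean \<Omega> (\<lambda>y. f (u s y)) * measure lebesgue \<Omega>"
        using Linf_integrable[OF M(1) Linf_compose_continuous[OF f u[of s]]] s M(1,3)
        by (subst Bochner_Integration.integral_diff) (auto intro: finite_measure.integrable_const)
      also have "\<dots> = 0"
        using M(2) by (simp add: mean_def)
      finally have "(I has_real_derivative 0) (at s within {0..})"
        using dI[of s] s by simp
      moreover have "at s within {0..} = at s"
        using s by (intro at_within_interior) simp
      ultimately show "(I has_real_derivative 0) (at s)" by simp
    qed (use False t in simp)
  qed simp
  also have "I 0 = (\<integral>x. u0 x \<partial>?M)"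
    unfolding I_def using init u[of 0] u0 by (intro integral_cong_AE) (auto simp: Linf_def)
  finally show ?thesis by (simp add: I_def mean_def)
qed

section \<open>Exponential decay of the oscillation along solutions\<close>

text \<open>Up to an error \<open>e / 2 * h\<close>, the solution at time \<open>t + h\<close> is
  one Euler step from \<open>u t\<close>; the step estimate doubles this error to
  \<open>e * h\<close>.\<close>

lemma ess_osc_Dini_estimate:
  assumes ne: "ae_filter M \<noteq> bot" and f: "f C1_differentiable_on UNIV"
    and u: "u t \<in> Linf M" and der: "has_Linf_derivative M u v t"
    and ode: "AE x in M. v x = f (u t x) - l"
    and t: "0 \<le> t" and e: "0 < e"
  shows "\<forall>\<^sub>F h in at_right 0. ess_osc M (u (t + h))
    \<le> ess_osc M (u t) + h * (f (essup M (u t)) - f (- essup M (\<lambda>x. - u t x))) + e * h"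
proof -
  obtain C where C: "AE x in M. \<bar>u t x\<bar> \<le> C"
    using Linf_AE_bounded[OF u] by metis
  obtain L where L: "0 \<le> L" "\<And>x y. \<lbrakk>x \<in> {- essup M (\<lambda>x. - u t x)..essup M (u t)};
      y \<in> {- essup M (\<lambda>x. - u t x)..essup M (u t)}\<rbrakk> \<Longrightarrow> \<bar>f x - f y\<bar> \<le> L * \<bar>x - y\<bar>"
    using C1_imp_Lipschitz_on_interval[OF f] by metis
  have "\<forall>\<^sub>F s in at t within {0..}. AE x in M. \<bar>u s x - u t x - (s - t) * v x\<bar> \<le> e / 2 * \<bar>s - t\<bar>"
    using e by (intro has_Linf_derivativeD[OF der]) simp
  then have "\<forall>\<^sub>F s in at_right t. AE x in M. \<bar>u s x - u t x - (s - t) * v x\<bar> \<le> e / 2 * \<bar>s - t\<bar>"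
    by (rule filter_leD[OF at_le, rotated]) (use t in auto)
  then have "\<forall>\<^sub>F h in at_right 0. AE x in M. \<bar>u (t + h) x - u t x - h * v x\<bar> \<le> e / 2 * \<bar>h\<bar>"
    by (simp add: eventually_at_right_to_0[of _ t] add.commute)
  \<comment> \<open>This ensures \<open>h * L \<le> 1\<close>, the monotonicity condition of the
    Euler step, also when \<open>L = 0\<close>.\<close>
  moreover have "\<forall>\<^sub>F h in at_right (0::real). h < 1 / (L + 1)"
    using L by (intro order_tendstoD(2)[OF tendsto_ident_at]) auto
  ultimately show ?thesis
    using eventually_at_right_less[of 0]
  proof eventually_elim
    case (elim h)
    have "h * (L + 1) \<le> 1"
      using elim(2) L by (simp add: field_simps)
    then have hL: "h * L \<le> 1"
      using elim(3) by (simp add: algebra_simps)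
    have "AE x in M. \<bar>u (t + h) x - u t x - h * (f (u t x) - l)\<bar> \<le> e / 2 * h"
      using elim(1) ode by eventually_elim (use elim(3) in simp)
    from ess_osc_Euler_step[OF ne C refl refl L(2) elim(3) hL this]
    show ?case by simp
  qed
qed

lemma solves_P_exponential_decay:
  assumes \<Omega>: "open \<Omega>" "bounded \<Omega>" "\<Omega> \<noteq> {}"
    and f: "f C1_differentiable_on UNIV"
    and sign: "\<And>s. s \<noteq> mean \<Omega> u0 \<Longrightarrow> (f s - f (mean \<Omega> u0)) * (s - mean \<Omega> u0) < 0"
    and f': "deriv f (mean \<Omega> u0) < 0"
    and u0: "u0 \<in> Linf (lebesgue_on \<Omega>)" and sol: "solves_P \<Omega> f u0 u"
  obtains C c where "0 < C" "0 < c"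
    "\<And>t. 0 \<le> t \<Longrightarrow> AE x in lebesgue_on \<Omega>. \<bar>u t x - mean \<Omega> u0\<bar> \<le> C * exp (- c * t)"
proof -
  let ?M = "lebesgue_on \<Omega>"
  define \<mu> where "\<mu> = mean \<Omega> u0"
  note M = lebesgue_on_bounded_open[OF \<Omega>]
  obtain v where C1: "C1_Linf ?M u v"
    and ode: "\<And>t. 0 < t \<Longrightarrow> AE x in ?M. v t x = f (u t x) - mean \<Omega> (\<lambda>y. f (u t y))"
    using sol unfolding solves_P_def by blast
  have u: "\<And>t. 0 \<le> t \<Longrightarrow> u t \<in> Linf ?M" and v: "\<And>t. 0 \<le> t \<Longrightarrow> v t \<in> Linf ?M"
    and der: "\<And>t. 0 \<le> t \<Longrightarrow> has_Linf_derivative ?M u (v t) t"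
    using C1 by (auto simp: C1_Linf_def continuous_Linf_def)
  have contf: "continuous_on UNIV f"
    using f by (rule C1_differentiable_imp_continuous_on)
  define a where "a = (\<lambda>t. - essup ?M (\<lambda>x. - u t x))"
  define b where "b = (\<lambda>t. essup ?M (u t))"
  define w where "w = (\<lambda>t. ess_osc ?M (u t))"
  have w: "w t = b t - a t" for t
    by (simp add: w_def a_def b_def ess_osc_def)
  have AE_ab: "AE x in ?M. a t \<le> u t x" "AE x in ?M. u t x \<le> b t" if "0 \<le> t" for t
    using Linf_AE_bounded[OF u[OF that]] unfolding a_def b_def
    by (metis AE_ge_essup_uminus, metis AE_le_essup)
  have ab: "a t \<le> \<mu>" "\<mu> \<le> b t" if "0 \<le> t" for t
    using mean_between[OF \<Omega> u[OF that] AE_ab[OF that]] solves_P_mean_conserved[OF \<Omega> contf u0 sol that]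
    by (simp_all add: \<mu>_def)
  have dini: "\<forall>\<^sub>F h in at_right 0. w (t + h) \<le> w t + h * (f (b t) - f (a t)) + e * h"
    if "0 < t" "0 < e" for t e
    unfolding w_def a_def b_def
    using ess_osc_Dini_estimate[OF M(4) f u der ode, of t e] that by simp
  have contw: "continuous_on {0..B} w" for B
    unfolding continuous_on_def
  proof
    fix t assume "t \<in> {0..B}"
    then have t: "0 \<le> t" by simp
    obtain K C where "AE x in ?M. \<bar>v t x\<bar> \<le> K" "AE x in ?M. \<bar>u t x\<bar> \<le> C"
      using Linf_AE_bounded[OF u[OF t]] Linf_AE_bounded[OF v[OF t]] by metis
    from has_Linf_derivative_imp_ess_osc_continuous[OF M(4) der[OF t] this]
    have "(w \<longlongrightarrow> w t) (at t within {0..})"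
      by (simp add: w_def)
    then show "(w \<longlongrightarrow> w t) (at t within {0..B})"
      by (rule tendsto_within_subset) auto
  qed
  \<comment> \<open>A first pass without a rate: as \<open>a t \<le> \<mu> \<le> b t\<close>, it
    confines both ends to within \<open>w 0\<close> of \<open>\<mu>\<close>, the compact range on
    which the rate \<open>c\<close> is then chosen.\<close>
  have le0: "w t \<le> w 0" if "0 \<le> t" for t
  proof (rule Dini_nonpos_imp_le[OF contw that])
    fix s e :: real assume s: "0 < s" "s < t" "0 < e"
    have "f (b s) \<le> f \<mu>"
      using ab[of s] s sign[of "b s"] by (cases "b s = \<mu>") (auto simp: \<mu>_def mult_less_0_iff)
    moreover have "f \<mu> \<le> f (a s)"
      using ab[of s] s sign[of "a s"] by (cases "a s = \<mu>") (auto simp: \<mu>_def mult_less_0_iff)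
    ultimately have le: "f (b s) - f (a s) \<le> 0" by simp
    show "\<forall>\<^sub>F h in at_right 0. w (s + h) \<le> w s + e * h"
      using dini[OF s(1,3)] eventually_at_right_less[of 0]
    proof eventually_elim
      case (elim h)
      have "h * (f (b s) - f (a s)) \<le> 0"
        using le elim by (intro mult_nonneg_nonpos) auto
      with elim show ?case by linarith
    qed
  qed
  have nonneg: "0 \<le> w t" if "0 \<le> t" for t
    using ab[OF that] by (simp add: w)
  obtain c where c: "0 < c" "\<And>a b. \<lbrakk>\<mu> - w 0 \<le> a; a \<le> \<mu>; \<mu> \<le> b; b \<le> \<mu> + w 0\<rbrakk>
      \<Longrightarrow> f b - f a \<le> - c * (b - a)"
    using decay_rate_exists[OF f nonneg[OF order_refl], of \<mu>] sign f' unfolding \<mu>_def by metis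
  have decay: "w t \<le> w 0 * exp (- c * t)" if "0 \<le> t" for t
  proof (rule Dini_Gronwall[OF contw that])
    fix s e :: real assume s: "0 < s" "s < t" "0 < e"
    have le: "f (b s) - f (a s) \<le> - c * w s"
      unfolding w using ab[of s] s le0[of s] by (intro c(2)) (auto simp: w[of s])
    show "\<forall>\<^sub>F h in at_right 0. w (s + h) \<le> w s - h * (c * w s) + e * h"
      using dini[OF s(1,3)] eventually_at_right_less[of 0]
    proof eventually_elim
      case (elim h)
      have "h * (f (b s) - f (a s)) \<le> h * (- c * w s)"
        using le elim by (intro mult_left_mono) auto
      with elim show ?case by simp
    qed
  qed (use c nonneg in auto)
  show ?thesis
  \<comment> \<open>The constant has to be positive, while \<open>w 0\<close> may be 0; hence the
    added 1.\<close>
  proof (rule that[of "w 0 + 1" c])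
    fix t :: real assume t: "0 \<le> t"
    have "w t \<le> (w 0 + 1) * exp (- c * t)"
      using decay[OF t] by (simp add: algebra_simps add_increasing)
    then have le: "b t - a t \<le> (w 0 + 1) * exp (- c * t)"
      by (simp only: w)
    \<comment> \<open>Both \<open>u t x\<close> and \<open>\<mu>\<close> lie between
      \<open>a t\<close> and \<open>b t\<close>, so their distance is at most
      \<open>w t\<close>.\<close>
    from AE_ab[OF t] show "AE x in ?M. \<bar>u t x - mean \<Omega> u0\<bar> \<le> (w 0 + 1) * exp (- c * t)"
      unfolding \<mu>_def[symmetric] by eventually_elim (use ab[OF t] le in linarith)
  qed (use c nonneg[of 0] in auto)
qed

section \<open>Limits in the mean and the omega-limit set\<close>

text \<open>By the triangle inequality the distance of the two limits is at most a sum tending to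
  0.\<close>

lemma AE_eq_if_tendsto_L1:
  fixes g :: "nat \<Rightarrow> 'a \<Rightarrow> real"
  assumes "\<And>n. integrable M (g n)" "integrable M \<phi>" "integrable M \<psi>"
    and "(\<lambda>n. \<integral>x. \<bar>g n x - \<phi> x\<bar> \<partial>M) \<longlonglongrightarrow> 0" "(\<lambda>n. \<integral>x. \<bar>g n x - \<psi> x\<bar> \<partial>M) \<longlonglongrightarrow> 0"
  shows "AE x in M. \<phi> x = \<psi> x"
proof -
  have le: "(\<integral>x. \<bar>\<phi> x - \<psi> x\<bar> \<partial>M) \<le> (\<integral>x. \<bar>g n x - \<phi> x\<bar> \<partial>M) + (\<integral>x. \<bar>g n x - \<psi> x\<bar> \<partial>M)" for n
  proof -
    have "(\<integral>x. \<bar>\<phi> x - \<psi> x\<bar> \<partial>M) \<le> (\<integral>x. \<bar>g n x - \<phi> x\<bar> + \<bar>g n x - \<psi> x\<bar> \<partial>M)"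
      using assms(1-3) by (intro integral_mono) auto
    then show ?thesis
      using assms(1-3) by simp
  qed
  have "(\<lambda>n. (\<integral>x. \<bar>g n x - \<phi> x\<bar> \<partial>M) + (\<integral>x. \<bar>g n x - \<psi> x\<bar> \<partial>M)) \<longlonglongrightarrow> 0 + 0"
    by (intro tendsto_add assms)
  then have "(\<integral>x. \<bar>\<phi> x - \<psi> x\<bar> \<partial>M) \<le> 0 + 0"
    by (rule LIMSEQ_le_const) (use le in blast)
  then have "(\<integral>x. \<bar>\<phi> x - \<psi> x\<bar> \<partial>M) = 0"
    by (intro antisym) auto
  then have "AE x in M. \<bar>\<phi> x - \<psi> x\<bar> = 0"
    using assms by (subst (asm) integral_nonneg_eq_0_iff_AE) auto
  then show ?thesis by eventually_elim simp
qed

lemma ae_class_eqI: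
  assumes "AE x in M. \<phi> x = \<psi> x"
  shows "ae_class M \<phi> = ae_class M \<psi>"
proof -
  have "(AE x in M. h x = \<phi> x) \<longleftrightarrow> (AE x in M. h x = \<psi> x)" for h
    by (rule eventually_subst) (use assms in \<open>eventually_elim, simp\<close>)
  then show ?thesis by (simp add: ae_class_def)
qed

theorem theorem1p5:
  fixes \<Omega> :: "(real ^ 'n) set"
    and f :: "real \<Rightarrow> real"
    and m M s_low s_upp :: real
    and u0 :: "real ^ 'n \<Rightarrow> real"
    and u :: "real \<Rightarrow> real ^ 'n \<Rightarrow> real"
  assumes "open \<Omega>" and "bounded \<Omega>" and "\<Omega> \<noteq> {}"
    and "bistable f m M s_low s_upp"
    and "u0 \<in> Linf (lebesgue_on \<Omega>)"
    and "mean \<Omega> u0 \<notin> {s_low..s_upp}"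
    and "solves_P \<Omega> f u0 u"
  shows "omega_limit \<Omega> f u0 = {ae_class (lebesgue_on \<Omega>) (\<lambda>x. mean \<Omega> u0)} \<and>
    (\<exists>C1 C2. C1 > 0 \<and> C2 > 0 \<and>
      (\<forall>t\<ge>0. Linf_norm (lebesgue_on \<Omega>) (\<lambda>x. u t x - mean \<Omega> u0) \<le> ereal (C1 * exp (- C2 * t))))"
proof -
  let ?M = "lebesgue_on \<Omega>"
  define \<mu> where "\<mu> = mean \<Omega> u0"
  note M = lebesgue_on_bounded_open[OF assms(1-3)]
  \<comment> \<open>Since \<open>s_low < m\<close> and \<open>M < s_upp\<close>, the mean lies on
    one of the outer branches, where the derivative is negative.\<close>
  have C1: "f C1_differentiable_on UNIV" and f': "deriv f (mean \<Omega> u0) < 0"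
    using assms(4,6) unfolding bistable_def by auto
  \<comment> \<open>Decay and convergence are established for every solution, because
    \<open>omega_limit\<close> lets the solution vary; the constants may depend on it.\<close>
  have decay: "\<exists>C c. 0 < C \<and> 0 < c \<and> (\<forall>t\<ge>0. AE x in ?M. \<bar>u t x - \<mu>\<bar> \<le> C * exp (- c * t))"
    if "solves_P \<Omega> f u0 u" for u
    using solves_P_exponential_decay[OF assms(1-3) C1 bistable_outer_sign[OF assms(4,6)] f' assms(5) that]
    unfolding \<mu>_def by metis
  have Linf_u: "u t \<in> Linf ?M" if "solves_P \<Omega> f u0 u" "0 \<le> t" for u t
    using that unfolding solves_P_def C1_Linf_def by blast
  have int_u: "integrable ?M (u t)" if "solves_P \<Omega> f u0 u" "0 \<le> t" for u t
    using Linf_integrable[OF M(1) Linf_u[OF that]] .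
  have int_c: "integrable ?M (\<lambda>x. \<mu>)"
    using M(1) by (rule finite_measure.integrable_const)
  have L1: "(\<lambda>n. \<integral>x. \<bar>u (\<tau> n) x - \<mu>\<bar> \<partial>?M) \<longlonglongrightarrow> 0"
    if sol: "solves_P \<Omega> f u0 u" and \<tau>: "\<And>n::nat. 0 \<le> \<tau> n" "filterlim \<tau> at_top sequentially" for u \<tau>
  proof -
    obtain C c where c: "0 < C" "0 < c"
      and d: "\<And>t. 0 \<le> t \<Longrightarrow> AE x in ?M. \<bar>u t x - \<mu>\<bar> \<le> C * exp (- c * t)"
      using decay[OF sol] by blast
    have bound: "norm (\<integral>x. \<bar>u (\<tau> n) x - \<mu>\<bar> \<partial>?M) \<le> C * exp (- c * \<tau> n) * measure lebesgue \<Omega>" for n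
      using abs_integral_le_const[OF M(1), of "\<lambda>x. \<bar>u (\<tau> n) x - \<mu>\<bar>"] d[OF \<tau>(1)] int_u[OF sol \<tau>(1)] int_c
      unfolding M(3) real_norm_def by simp
    have "LIM n sequentially. c * \<tau> n :> at_top"
      by (rule filterlim_tendsto_pos_mult_at_top[OF tendsto_const c(2) \<tau>(2)])
    then have "(\<lambda>n. exp (- (c * \<tau> n))) \<longlonglongrightarrow> 0"
      by (intro filterlim_compose[OF exp_at_bot]) (simp add: filterlim_uminus_at_bot)
    then have "(\<lambda>n. C * exp (- c * \<tau> n) * measure lebesgue \<Omega>) \<longlonglongrightarrow> 0"
      by (intro tendsto_mult_left_zero tendsto_mult_right_zero) simp
    then show ?thesis
      by (rule Lim_null_comparison[OF always_eventually, rotated]) (use bound in blast)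
  qed
  have "omega_limit \<Omega> f u0 = {ae_class ?M (\<lambda>x. \<mu>)}"
  proof (intro equalityI subsetI)
    fix A assume "A \<in> omega_limit \<Omega> f u0"
    then obtain \<phi> v \<tau> where A: "A = ae_class ?M \<phi>" and \<phi>: "integrable ?M \<phi>"
      and v: "solves_P \<Omega> f u0 v" and \<tau>: "\<And>n::nat. 0 \<le> \<tau> n" "filterlim \<tau> at_top sequentially"
      and lim: "(\<lambda>n. \<integral>x. \<bar>v (\<tau> n) x - \<phi> x\<bar> \<partial>?M) \<longlonglongrightarrow> 0"
      unfolding omega_limit_def by blast
    have "AE x in ?M. \<phi> x = \<mu>"
      by (rule AE_eq_if_tendsto_L1[OF int_u[OF v \<tau>(1)] \<phi> int_c lim L1[OF v \<tau>]])
    then show "A \<in> {ae_class ?M (\<lambda>x. \<mu>)}"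
      unfolding A by (simp add: ae_class_eqI)
  next
    fix A assume "A \<in> {ae_class ?M (\<lambda>x. \<mu>)}"
    \<comment> \<open>The given solution along the times \<open>real n\<close> shows that the class
      of the constant is indeed a limit.\<close>
    moreover have "(\<lambda>n. \<integral>x. \<bar>u (real n) x - \<mu>\<bar> \<partial>?M) \<longlonglongrightarrow> 0"
      by (rule L1[OF assms(7)]) (auto intro: filterlim_real_sequentially)
    ultimately show "A \<in> omega_limit \<Omega> f u0"
      unfolding omega_limit_def using assms(7) int_c
      by (intro CollectI exI[of _ "\<lambda>x. \<mu>"] conjI exI[of _ u] exI[of _ real])
        (auto intro: filterlim_real_sequentially)
  qed
  moreover obtain C c where "0 < C" "0 < c"
    and d: "\<And>t. 0 \<le> t \<Longrightarrow> AE x in ?M. \<bar>u t x - \<mu>\<bar> \<le> C * exp (- c * t)"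
    using decay[OF assms(7)] by blast
  moreover have "Linf_norm ?M (\<lambda>x. u t x - \<mu>) \<le> ereal (C * exp (- c * t))" if "0 \<le> t" for t
    using Linf_u[OF assms(7) that] d[OF that] by (intro Linf_norm_le) (auto simp: Linf_def)
  ultimately show ?thesis
    unfolding \<mu>_def by blast
qed

end
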